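(* Let $a_1 < a_2 < a_3$ be positive real numbers such that the set $\{a_1,a_2,a_3\}$ is linearly independent over the rational numbers, and let the non-zero real numbers $c_1$, $c_2$, $c_3$ be such that \[ c_1 > 0, \qquad c_1 + c_2 + c_3 = 0, \qquad \text{and} \qquad a_1 c_1 + a_2 c_2 + a_3 c_3 = 0. \] Then the function $N : \mathbb{R} \to \mathbb{R}$ defined by \[ N(x) = \begin{cases} c_1 e^{-a_1 x} + c_2 e^{-a_2 x} + c_3 e^{-a_3 x} & \text{if } x \geq 0, \\ 0 & \text{if } x < 0 \end{cases} \] is a continuous Pólya frequency function such that $N^n : x \mapsto N(x)^n$ is not a Pólya frequency function for any integer $n \geq 2$.
   Context: A Pólya frequency function is a function $\Lambda : \mathbb{R} \to [0,\infty)$ that is Lebesgue integrable, non-zero at two or more points, and such that $\det(\Lambda(x_i-y_j))_{i,j=1}^n \geq 0$ for all $n \in \mathbb{N}$ and all real $x_1 < \cdots < x_n$ and $y_1 < \cdots < y_n$. *)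

theory Defs
  imports "HOL-Analysis.Analysis" "Jordan_Normal_Form.Determinant"
begin

(* Points x_1 < ... < x_n are the values x 0 < ... < x (n - 1) of a sequence.  The order n of the
   determinant varies inside the definition, so the matrices are those of Jordan_Normal_Form. *)
definition totally_nonneg_kernel :: "(real \<Rightarrow> real) \<Rightarrow> bool" where
  "totally_nonneg_kernel \<Lambda> \<longleftrightarrow>
     (\<forall>(n::nat) (x::nat \<Rightarrow> real) (y::nat \<Rightarrow> real).
        strict_mono_on {..<n} x \<longrightarrow> strict_mono_on {..<n} y \<longrightarrow>
        Determinant.det (Matrix.mat n n (\<lambda>(i, j). \<Lambda> (x i - y j))) \<ge> 0)"

definition polya_frequency_function :: "(real \<Rightarrow> real) \<Rightarrow> bool" where
  "polya_frequency_function \<Lambda> \<longleftrightarrow>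
     (\<forall>x. \<Lambda> x \<ge> 0) \<and>
     integrable lebesgue \<Lambda> \<and>
     (\<exists>x y. x \<noteq> y \<and> \<Lambda> x \<noteq> 0 \<and> \<Lambda> y \<noteq> 0) \<and>
     totally_nonneg_kernel \<Lambda>"

abbreviation rat_independent :: "real set \<Rightarrow> bool" where
  "rat_independent \<equiv> Modules.module.independent (\<lambda>(q::rat) (x::real). of_rat q * x)"

end

(* Up to a positive factor N is the convolution of the kernels e^(-a_i x) 1_{x >= 0}.  The kernel
   1_{x >= 0} is totally nonnegative, multiplication by an exponential preserves total
   nonnegativity, and so does passing to a primitive; N arises from 1_{x >= 0} by these operations.

   Conversely, let sum_k b_k e^(-beta_k x) with beta_0 < beta_1 < ... and all b_k nonzero be totally
   nonnegative on x >= 0.  Sending x_(p-1), x_(p-2), ..., x_0 to infinity in a minor of order p leaves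
   b_0 ... b_(p-1) times a minor of the exponentials, which has sign (-1)^(p(p-1)/2); hence the
   signs of the b_k alternate and their sum is 0 or 1.  By the linear independence of the a_i, the
   n-th power of N is such a sum with one exponent for each (k, l) with k + l <= n and
   coefficient of sign (-1)^k, and these signs add up to n div 2 + 1, which exceeds 1 if n >= 2. *)

theory Submission
  imports Defs
begin

section \<open>Determinants of square arrays\<close>

text \<open>Rows are functions, so replacing row \<open>i\<close> is the update
  \<open>f(i := r)\<close>, and only entries with both indices below \<open>n\<close>
  matter.\<close>

definition fdet :: "nat \<Rightarrow> (nat \<Rightarrow> nat \<Rightarrow> real) \<Rightarrow> real" where
  "fdet n f = Determinant.det (Matrix.mat n n (\<lambda>(i, j). f i j))"

lemma totally_nonneg_kernel_fdet:
  "totally_nonneg_kernel \<Lambda> \<longleftrightarrow>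
     (\<forall>n x y. strict_mono_on {..<n} x \<longrightarrow> strict_mono_on {..<n} y \<longrightarrow>
        fdet n (\<lambda>i j. \<Lambda> (x i - y j)) \<ge> 0)"
  by (simp add: totally_nonneg_kernel_def fdet_def)

lemma fdet_cong:
  assumes "\<And>i j. i < n \<Longrightarrow> j < n \<Longrightarrow> f i j = g i j"
  shows "fdet n f = fdet n g"
proof -
  have "Matrix.mat n n (\<lambda>(i, j). f i j) = Matrix.mat n n (\<lambda>(i, j). g i j)"
    using assms by (intro eq_matI) auto
  then show ?thesis by (simp add: fdet_def)
qed

lemma fdet_0 [simp]: "fdet 0 f = 1"
  by (simp add: fdet_def)

lemma fdet_transpose: "fdet n (\<lambda>i j. f j i) = fdet n f"
proof -
  have "Matrix.mat n n (\<lambda>(i, j). f j i) = transpose_mat (Matrix.mat n n (\<lambda>(i, j). f i j))"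
    by (intro eq_matI) auto
  then show ?thesis
    unfolding fdet_def by (simp add: Determinant.det_transpose[of _ n])
qed

lemma fdet_identical_rows:
  assumes "i < n" "k < n" "i \<noteq> k" "\<And>j. j < n \<Longrightarrow> f i j = f k j"
  shows "fdet n f = 0"
  unfolding fdet_def
  by (rule Determinant.det_identical_rows[where n = n and i = i and j = k])
     (use assms in \<open>auto intro!: eq_vecI\<close>)

lemma fdet_identical_columns:
  assumes "j < n" "k < n" "j \<noteq> k" "\<And>i. i < n \<Longrightarrow> f i j = f i k"
  shows "fdet n f = 0"
proof -
  have "fdet n (\<lambda>i j. f j i) = 0"
    by (rule fdet_identical_rows[OF assms(1-3)]) (rule assms(4))
  then show ?thesis by (simp only: fdet_transpose[of n f])
qed

text \<open>The cofactors along row \<open>i\<close> do not involve that row, so one family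
  \<open>C\<close> serves for every \<open>r\<close>. This linear form carries limits and integrals
  through a determinant one row at a time.\<close>

lemma fdet_row_expansion:
  assumes "i < n"
  obtains C where "\<And>r. fdet n (f(i := r)) = (\<Sum>j<n. r j * C j)"
proof
  fix r
  define A where "A = (\<lambda>r. Matrix.mat n n (\<lambda>(a, b). (f(i := r)) a b))"
  have "mat_delete (A r) i j = mat_delete (A (\<lambda>_. 0)) i j" if "j < n" for j
    using assms that by (intro eq_matI) (auto simp: mat_delete_def A_def)
  then have cof: "cofactor (A r) i j = cofactor (A (\<lambda>_. 0)) i j" if "j < n" for j
    using that by (simp add: cofactor_def)
  have "fdet n (f(i := r)) = (\<Sum>j<n. A r $$ (i, j) * cofactor (A r) i j)"
    unfolding fdet_def A_def by (rule laplace_expansion_row) (use assms in auto)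
  also have "\<dots> = (\<Sum>j<n. r j * cofactor (A (\<lambda>_. 0)) i j)"
  proof (rule sum.cong)
    fix j assume "j \<in> {..<n}"
    then show "A r $$ (i, j) * cofactor (A r) i j = r j * cofactor (A (\<lambda>_. 0)) i j"
      using cof[of j] assms by (simp add: A_def)
  qed simp
  finally show "fdet n (f(i := r)) = (\<Sum>j<n. r j * cofactor (A (\<lambda>_. 0)) i j)" .
qed

lemma fdet_row_zero:
  assumes "i < n" "\<And>j. j < n \<Longrightarrow> f i j = 0"
  shows "fdet n f = 0"
proof -
  obtain C where C: "\<And>r. fdet n (f(i := r)) = (\<Sum>j<n. r j * C j)"
    using fdet_row_expansion[OF assms(1)] by metis
  show ?thesis using C[of "f i"] assms(2) by simp
qed

text \<open>Laplace expansion along the row leaves one cofactor; \<open>insert_index i\<close> skips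
  the value \<open>i\<close> and so renumbers what remains.\<close>

lemma fdet_unit_row:
  assumes "i \<le> n" "c \<le> n" "\<And>j. j \<le> n \<Longrightarrow> f i j = (if j = c then 1 else 0)"
  shows "fdet (Suc n) f = (-1) ^ (i + c) * fdet n (\<lambda>a b. f (insert_index i a) (insert_index c b))"
proof -
  let ?A = "Matrix.mat (Suc n) (Suc n) (\<lambda>(i, j). f i j)"
  have "fdet (Suc n) f = (\<Sum>j<Suc n. ?A $$ (i, j) * cofactor ?A i j)"
    unfolding fdet_def by (rule laplace_expansion_row) (use assms in auto)
  also have "\<dots> = (\<Sum>j<Suc n. if j = c then cofactor ?A i j else 0)"
    using assms by (intro sum.cong) auto
  also have "\<dots> = cofactor ?A i c"
    using assms by (subst sum.delta) auto
  also have "mat_delete ?A i c = Matrix.mat n n (\<lambda>(a, b). f (insert_index i a) (insert_index c b))"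
    using assms by (intro eq_matI) (auto simp: mat_delete_def insert_index_def)
  then have "cofactor ?A i c = (-1) ^ (i + c) * fdet n (\<lambda>a b. f (insert_index i a) (insert_index c b))"
    unfolding cofactor_def fdet_def by simp
  finally show ?thesis .
qed

text \<open>Every term of the Leibniz formula contains each \<open>u i\<close> and each
  \<open>v j\<close> exactly once.\<close>

lemma fdet_scale:
  "fdet n (\<lambda>i j. u i * v j * f i j) = (\<Prod>i<n. u i) * (\<Prod>j<n. v j) * fdet n f"
proof -
  have expand: "fdet n g = (\<Sum>p | p permutes {0..<n}. signof p * (\<Prod>i = 0..<n. g i (p i)))" for g
  proof -
    have "fdet n g = (\<Sum>p | p permutes {0..<n}. signof p *
        (\<Prod>i = 0..<n. Matrix.mat n n (\<lambda>(i, j). g i j) $$ (i, p i)))"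
      unfolding fdet_def by (rule Determinant.det_def') auto
    also have "\<dots> = (\<Sum>p | p permutes {0..<n}. signof p * (\<Prod>i = 0..<n. g i (p i)))"
      by (intro sum.cong refl arg_cong2[where f = "(*)"] prod.cong)
         (auto dest: permutes_in_image)
    finally show ?thesis .
  qed
  have v: "(\<Prod>i = 0..<n. v (p i)) = (\<Prod>j = 0..<n. v j)" if "p permutes {0..<n}" for p
    using prod.permute[OF that, of v] by (simp add: comp_def)
  show ?thesis
    unfolding expand sum_distrib_left
    by (intro sum.cong refl) (simp add: prod.distrib v lessThan_atLeast0)
qed

text \<open>Subtracting from each row its predecessor is left multiplication by the bidiagonal
  matrix \<open>L\<close>, with 1 on the diagonal and -1 below it, whose determinant is 1.\<close>

lemma fdet_row_differences:
  "fdet n (\<lambda>i. if i = 0 then f 0 else (\<lambda>j. f i j - f (i - 1) j)) = fdet n f"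
proof -
  define L :: "real mat" where
    "L = Matrix.mat n n (\<lambda>(i, k). if k = i then 1 else if Suc k = i then -1 else 0)"
  have L_carrier: "L \<in> carrier_mat n n" by (simp add: L_def)
  let ?F = "Matrix.mat n n (\<lambda>(i, j). f i j)"
  have "Determinant.det L = prod_list (diag_mat L)"
    by (rule Determinant.det_lower_triangular[where n = n]) (auto simp: L_def)
  also have "diag_mat L = map (\<lambda>_. 1) [0..<n]"
    by (auto simp: diag_mat_def L_def)
  also have "prod_list \<dots> = (1 :: real)"
    by (simp add: map_replicate_const prod_list_replicate)
  finally have detL: "Determinant.det L = 1" .
  have entry: "(\<Sum>k<n. (if k = i then 1 else if Suc k = i then -1 else 0) * f k j) =
        (if i = 0 then f 0 j else f i j - f (i - 1) j)" if "i < n" for i j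
  proof (cases i)
    case 0
    then show ?thesis using that
      by (simp add: if_distrib[of "\<lambda>x. x * _"] sum.delta cong: if_cong)
  next
    case (Suc m)
    have "(\<Sum>k<n. (if k = i then 1 else if Suc k = i then -1 else 0) * f k j) =
          (\<Sum>k<n. (if k = i then f k j else 0) - (if k = m then f k j else 0))"
      by (intro sum.cong) (auto simp: Suc)
    also have "\<dots> = f i j - f m j"
      using that Suc by (simp add: sum_subtractf)
    finally show ?thesis by (simp add: Suc)
  qed
  have "L * ?F = Matrix.mat n n (\<lambda>(i, j). (if i = 0 then f 0 else (\<lambda>j. f i j - f (i - 1) j)) j)"
  proof (intro eq_matI)
    fix i j assume ij: "i < dim_row (Matrix.mat n n (\<lambda>(i, j). (if i = 0 then f 0 else (\<lambda>j. f i j - f (i - 1) j)) j))"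
      "j < dim_col (Matrix.mat n n (\<lambda>(i, j). (if i = 0 then f 0 else (\<lambda>j. f i j - f (i - 1) j)) j))"
    then have "(L * ?F) $$ (i, j) =
       (\<Sum>k<n. (if k = i then 1 else if Suc k = i then -1 else 0) * f k j)"
      by (simp add: L_def scalar_prod_def atLeast0LessThan)
    also have "\<dots> = (if i = 0 then f 0 j else f i j - f (i - 1) j)"
      using ij by (intro entry) simp
    finally show "(L * ?F) $$ (i, j) =
        Matrix.mat n n (\<lambda>(i, j). (if i = 0 then f 0 else (\<lambda>j. f i j - f (i - 1) j)) j) $$ (i, j)"
      using ij by auto
  qed (auto simp: L_def)
  then have "fdet n (\<lambda>i. if i = 0 then f 0 else (\<lambda>j. f i j - f (i - 1) j)) = Determinant.det (L * ?F)"
    by (simp add: fdet_def)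
  also have "\<dots> = fdet n f"
    by (subst Determinant.det_mult[of _ n]) (auto simp: detL fdet_def L_carrier)
  finally show ?thesis .
qed

section \<open>Operations preserving total nonnegativity\<close>

text \<open>Since exp(a(x - y)) = exp(ax) exp(-ay), each minor is only multiplied by nonnegative row
  and column factors.\<close>

lemma totally_nonneg_kernel_exp_scale:
  assumes "totally_nonneg_kernel \<Lambda>" "k \<ge> 0"
  shows "totally_nonneg_kernel (\<lambda>x. k * exp (a * x) * \<Lambda> x)"
  unfolding totally_nonneg_kernel_fdet
proof (intro allI impI)
  fix n :: nat and x y :: "nat \<Rightarrow> real"
  assume "strict_mono_on {..<n} x" "strict_mono_on {..<n} y"
  then have "0 \<le> (\<Prod>i<n. k * exp (a * x i)) * (\<Prod>j<n. exp (- a * y j)) *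
               fdet n (\<lambda>i j. \<Lambda> (x i - y j))"
    using assms by (intro mult_nonneg_nonneg prod_nonneg) (auto simp: totally_nonneg_kernel_fdet)
  also have "\<dots> = fdet n (\<lambda>i j. k * exp (a * x i) * exp (- a * y j) * \<Lambda> (x i - y j))"
    by (rule fdet_scale[symmetric])
  also have "\<dots> = fdet n (\<lambda>i j. k * exp (a * (x i - y j)) * \<Lambda> (x i - y j))"
    by (intro fdet_cong) (simp add: right_diff_distrib exp_diff exp_minus field_simps)
  finally show "0 \<le> fdet n (\<lambda>i j. k * exp (a * (x i - y j)) * \<Lambda> (x i - y j))" .
qed

text \<open>Induction on the order, by the position of the smallest \<open>x\<close>. If it lies
  below every \<open>y\<close>, the first row vanishes; if it is at least the two smallest
  \<open>y\<close>, the first two columns are equal; otherwise the first row is a unit vector, and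
  expansion leaves a smaller minor of the same kernel.\<close>

lemma totally_nonneg_kernel_heaviside:
  "totally_nonneg_kernel (\<lambda>x. if x \<ge> 0 then 1 else 0)"
proof -
  let ?H = "\<lambda>x :: real. if x \<ge> 0 then 1 else 0 :: real"
  have "fdet n (\<lambda>i j. ?H (x i - y j)) \<ge> 0"
    if "strict_mono_on {..<n} x" "strict_mono_on {..<n} y" for n x y
    using that
  proof (induction n arbitrary: x y)
    case 0
    show ?case by simp
  next
    case (Suc n)
    have x: "x 0 \<le> x i" if "i < Suc n" for i
      using strict_mono_on_leD[OF Suc.prems(1), of 0 i] that by auto
    have y: "y 0 \<le> y i" "1 \<le> i \<Longrightarrow> y 1 \<le> y i" if "i < Suc n" for i
      using strict_mono_on_leD[OF Suc.prems(2), of 0 i] strict_mono_on_leD[OF Suc.prems(2), of 1 i] that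
      by auto
    \<comment> \<open>The guards on \<open>n\<close> are there because \<open>y 1\<close> is one of
      the given points only if the order \<open>Suc n\<close> is at least 2.\<close>
    consider "x 0 < y 0" | "y 0 \<le> x 0" "n \<ge> 1" "y 1 \<le> x 0" | "y 0 \<le> x 0" "n \<ge> 1 \<longrightarrow> x 0 < y 1"
      by linarith
    then show ?case
    proof cases
      case 1
      have "fdet (Suc n) (\<lambda>i j. ?H (x i - y j)) = 0"
      proof (rule fdet_row_zero[of 0])
        fix j assume "j < Suc n"
        then show "?H (x 0 - y j) = 0" using y(1)[of j] 1 by simp
      qed simp
      then show ?thesis by simp
    next
      case 2
      have "fdet (Suc n) (\<lambda>i j. ?H (x i - y j)) = 0"
      proof (rule fdet_identical_columns[of 0 _ 1])
        fix i assume "i < Suc n"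
        then show "?H (x i - y 0) = ?H (x i - y 1)" using x[of i] 2 by simp
      qed (use 2 in auto)
      then show ?thesis by simp
    next
      case 3
      have "?H (x 0 - y j) = (if j = 0 then 1 else 0)" if "j \<le> n" for j
        using 3 y[of j] that by (cases "j = 0") auto
      then have "fdet (Suc n) (\<lambda>i j. ?H (x i - y j)) = fdet n (\<lambda>i j. ?H (x (Suc i) - y (Suc j)))"
        by (subst fdet_unit_row[where i = 0 and c = 0]) auto
      also have "\<dots> \<ge> 0"
        by (rule Suc.IH[of "\<lambda>i. x (Suc i)" "\<lambda>i. y (Suc i)"])
           (use Suc.prems in \<open>auto simp: strict_mono_on_def\<close>)
      finally show ?thesis .
    qed
  qed
  then show ?thesis unfolding totally_nonneg_kernel_fdet by blast
qed

text \<open>A determinant is linear in each row, so integrating one row integrates the determinant,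
  and nonnegativity passes from the sampled rows \<open>G (t i)\<close> to their integrals.\<close>

lemma fdet_integral_nonneg:
  fixes a b :: "nat \<Rightarrow> real"
  assumes int: "\<And>i j. i < n \<Longrightarrow> j < n \<Longrightarrow> ((\<lambda>t. G t j) has_integral R i j) {a i..b i}"
    and nonneg: "\<And>t. (\<And>i. i < n \<Longrightarrow> t i \<in> {a i..b i}) \<Longrightarrow> fdet n (\<lambda>i. G (t i)) \<ge> 0"
  shows "fdet n R \<ge> 0"
proof -
  \<comment> \<open>The first \<open>m\<close> rows are already integrated, the others still
    sampled. The claim is made for all such \<open>t\<close> because the induction step integrates
    over \<open>t m\<close>.\<close>
  have "fdet n (\<lambda>i. if i < m then R i else G (t i)) \<ge> 0"
    if "m \<le> n" "\<And>i. i < n \<Longrightarrow> m \<le> i \<Longrightarrow> t i \<in> {a i..b i}" for m and t :: "nat \<Rightarrow> real"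
    using that
  proof (induction m arbitrary: t)
    case 0
    then show ?case using nonneg[of t] by simp
  next
    case (Suc m)
    then have m: "m < n" by simp
    define f where "f = (\<lambda>i. if i < m then R i else G (t i))"
    obtain C where C: "\<And>r. fdet n (f(m := r)) = (\<Sum>j<n. r j * C j)"
      using fdet_row_expansion[OF m] by metis
    have "((\<lambda>s. fdet n (f(m := G s))) has_integral fdet n (f(m := R m))) {a m..b m}"
      unfolding C using m by (intro has_integral_sum has_integral_mult_left int) auto
    moreover have "fdet n (f(m := G s)) \<ge> 0" if s: "s \<in> {a m..b m}" for s
    proof -
      have "f(m := G s) = (\<lambda>i. if i < m then R i else G ((t(m := s)) i))"
        by (auto simp: f_def fun_eq_iff)
      moreover have "fdet n \<dots> \<ge> 0"
        by (rule Suc.IH) (use Suc.prems s in \<open>auto simp: Suc_le_eq\<close>)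
      ultimately show ?thesis by simp
    qed
    ultimately have "fdet n (f(m := R m)) \<ge> 0"
      by (rule has_integral_nonneg)
    also have "f(m := R m) = (\<lambda>i. if i < Suc m then R i else G (t i))"
      by (auto simp: f_def fun_eq_iff)
    finally show ?case .
  qed
  from this[of n "\<lambda>_. 0"] have "fdet n (\<lambda>i. if i < n then R i else G 0) \<ge> 0"
    by simp
  also have "fdet n (\<lambda>i. if i < n then R i else G 0) = fdet n R"
    by (rule fdet_cong) simp
  finally show ?thesis .
qed

text \<open>After subtracting consecutive rows, each row is an integral of \<open>f\<close> over one of the adjacent
  intervals \<open>[x\<^sub>i\<^sub>-\<^sub>1, x\<^sub>i]\<close>, so the points of integration come in increasing order.\<close>

lemma totally_nonneg_kernel_primitive:
  assumes f: "totally_nonneg_kernel f"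
    and g0: "\<And>x. x < 0 \<Longrightarrow> g x = 0"
    and g: "\<And>u v. u \<le> v \<Longrightarrow> (f has_integral (g v - g u)) {u..v}"
  shows "totally_nonneg_kernel g"
  unfolding totally_nonneg_kernel_fdet
proof (intro allI impI)
  fix n :: nat and x y :: "nat \<Rightarrow> real"
  assume x: "strict_mono_on {..<n} x" and y: "strict_mono_on {..<n} y"
  \<comment> \<open>Left of all \<open>y j\<close> the value \<open>g (z - y j)\<close> is 0, so the
    first row too is a difference of values of \<open>g\<close>. Inserting \<open>x 0\<close> gives
    \<open>z < x 0\<close> and keeps the set non-empty for \<open>n = 0\<close>.\<close>
  define z where "z = Min (insert (x 0) (y ` {..<n})) - 1"
  have "z < r" if "r \<in> insert (x 0) (y ` {..<n})" for r
    using Min_le[OF _ that] by (simp add: z_def)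
  then have z: "z < x 0" "\<And>j. j < n \<Longrightarrow> z < y j"
    by auto
  define X where "X = (\<lambda>i. if i = 0 then z else x (i - 1))"
  have X_le: "X i \<le> x i" if "i < n" for i
    using strict_mono_onD[OF x, of "i - 1" i] that z by (auto simp: X_def intro: less_imp_le)
  define R where "R = (\<lambda>i j. g (x i - y j) - g (X i - y j))"
  have "fdet n R \<ge> 0"
  proof (rule fdet_integral_nonneg[where G = "\<lambda>t j. f (t - y j)" and a = X and b = x])
    fix i j assume ij: "i < n" "j < n"
    have "(f has_integral R i j) {X i - y j..x i - y j}"
      unfolding R_def using X_le[OF ij(1)] by (intro g) auto
    from has_integral_affinity'[OF this[folded cbox_interval], of 1 "- y j"]
    show "((\<lambda>t. f (t - y j)) has_integral R i j) {X i..x i}"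
      by simp
  next
    fix t assume t: "\<And>i. i < n \<Longrightarrow> t i \<in> {X i..x i}"
    show "fdet n (\<lambda>i j. f (t i - y j)) \<ge> 0"
    proof (cases "strict_mono_on {..<n} t")
      case True
      then show ?thesis using f y by (auto simp: totally_nonneg_kernel_fdet)
    next
      case False
      \<comment> \<open>The intervals are adjacent, so points that fail to increase strictly can
        only coincide at a common endpoint, and two rows are equal.\<close>
      then obtain i k where ik: "i < k" "k < n" "t k \<le> t i"
        by (auto simp: strict_mono_on_def not_less)
      have "t i \<le> x i" using t[of i] ik by auto
      also have "x i \<le> x (k - 1)"
        using ik by (intro strict_mono_on_leD[OF x]) auto
      also have "x (k - 1) \<le> t k" using t[of k] ik by (auto simp: X_def)
      finally have "t i = t k" using ik by simp
      then have "fdet n (\<lambda>i j. f (t i - y j)) = 0"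
        using ik by (intro fdet_identical_rows[of i n k]) auto
      then show ?thesis by simp
    qed
  qed
  also have "fdet n R = fdet n (\<lambda>i. if i = 0 then (\<lambda>j. g (x 0 - y j))
                 else (\<lambda>j. g (x i - y j) - g (x (i - 1) - y j)))"
    using z by (intro fdet_cong) (auto simp: R_def X_def g0)
  also have "\<dots> = fdet n (\<lambda>i j. g (x i - y j))"
    by (rule fdet_row_differences)
  finally show "0 \<le> fdet n (\<lambda>i j. g (x i - y j))" .
qed

section \<open>Exponential sums\<close>

lemma exp_mult_tendsto_0:
  fixes c :: real
  assumes "c < 0"
  shows "((\<lambda>t. exp (c * t)) \<longlongrightarrow> 0) at_top"
  using assms
  by (intro filterlim_compose[OF exp_at_bot] filterlim_tendsto_neg_mult_at_bot[OF tendsto_const])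
     (auto simp: filterlim_ident)

text \<open>The sign of the determinant is read off by sending the points \<open>y\<^sub>i\<close> to infinity one at a time,
  the last one first.\<close>

lemma exp_minor_sign:
  fixes \<beta> :: "nat \<Rightarrow> real"
  assumes "strict_mono_on {..<p} \<beta>"
  shows "\<exists>y. strict_mono_on {..<p} y \<and>
           (\<Prod>k<p. (-1) ^ k) * fdet p (\<lambda>i j. exp (\<beta> (p - 1 - i) * y j)) > 0"
  using assms
proof (induction p)
  case 0
  show ?case by (auto simp: strict_mono_on_def)
next
  case (Suc p)
  have "strict_mono_on {..<p} \<beta>"
    using Suc.prems by (auto simp: strict_mono_on_def)
  from Suc.IH[OF this] obtain y where y: "strict_mono_on {..<p} y"
    and pos: "(\<Prod>k<p. (-1) ^ k) * fdet p (\<lambda>i j. exp (\<beta> (p - 1 - i) * y j)) > 0"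
    by blast
  \<comment> \<open>\<open>g\<close> is the transposed array: its row \<open>j\<close> belongs to
    the point \<open>y j\<close>, so a new last point is a new row \<open>p\<close>.\<close>
  define g where "g = (\<lambda>j i. exp (\<beta> (p - i) * y j))"
  define e :: real where "e = (\<Prod>k<Suc p. (-1) ^ k)"
  obtain C where C: "\<And>r. fdet (Suc p) (g(p := r)) = (\<Sum>i<Suc p. r i * C i)"
    using fdet_row_expansion[of p "Suc p" g] by auto
  define r where "r = (\<lambda>t i. exp (\<beta> (p - i) * t))"
  \<comment> \<open>Dividing the new row by its dominant entry, \<open>exp (\<beta> p * t)\<close>
    in column 0, turns it into a unit vector in the limit.\<close>
  have lim: "((\<lambda>t. exp (- \<beta> p * t) * r t i) \<longlongrightarrow> (if i = 0 then 1 else 0)) at_top"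
    if "i < Suc p" for i
  proof (cases "i = 0")
    case True
    then show ?thesis by (simp add: r_def flip: exp_add)
  next
    case False
    then have "\<beta> (p - i) - \<beta> p < 0"
      using strict_mono_onD[OF Suc.prems, of "p - i" p] that by simp
    from exp_mult_tendsto_0[OF this] show ?thesis
      using False by (simp add: r_def algebra_simps flip: exp_add)
  qed
  have "((\<lambda>t. e * (\<Sum>i<Suc p. (exp (- \<beta> p * t) * r t i) * C i))
          \<longlongrightarrow> e * (\<Sum>i<Suc p. (if i = 0 then 1 else 0) * C i)) at_top"
    using lim by (intro tendsto_intros) auto
  moreover have "e * (\<Sum>i<Suc p. (if i = 0 then 1 else 0) * C i) > 0"
  proof -
    have "(\<Sum>i<Suc p. (if i = 0 then 1 else 0) * C i) =
          fdet (Suc p) (g(p := (\<lambda>i. if i = 0 then 1 else 0)))"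
      by (simp only: C)
    \<comment> \<open>The expansion gives the sign \<open>(-1) ^ p\<close>, which cancels the last
      factor of \<open>e\<close>; deleting column 0 turns the index \<open>p - i\<close> into
      \<open>p - 1 - i\<close>.\<close>
    also have "\<dots> = (-1) ^ p * fdet p (\<lambda>a b. g a (Suc b))"
      by (subst fdet_unit_row[where i = p and c = 0])
         (auto intro!: fdet_cong simp: insert_index_def)
    also have "(\<lambda>a b. g a (Suc b)) = (\<lambda>a b. (\<lambda>i j. exp (\<beta> (p - 1 - i) * y j)) b a)"
      by (simp add: g_def)
    also have "fdet p \<dots> = fdet p (\<lambda>i j. exp (\<beta> (p - 1 - i) * y j))"
      by (rule fdet_transpose)
    finally have "e * (\<Sum>i<Suc p. (if i = 0 then 1 else 0) * C i) = ((-1) ^ p * (-1) ^ p) *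
        ((\<Prod>k<p. (-1) ^ k) * fdet p (\<lambda>i j. exp (\<beta> (p - 1 - i) * y j)))"
      unfolding e_def by (simp only: prod.lessThan_Suc mult_ac)
    then show ?thesis using pos by (simp flip: power_mult_distrib)
  qed
  ultimately have "\<forall>\<^sub>F t in at_top. e * (\<Sum>i<Suc p. (exp (- \<beta> p * t) * r t i) * C i) > 0"
    by (rule order_tendstoD)
  \<comment> \<open>For \<open>p = 0\<close> this bound refers to an arbitrary value
    \<open>y 0\<close>, which does no harm.\<close>
  with eventually_gt_at_top[of "y (p - 1)"]
  have "\<forall>\<^sub>F t in at_top. t > y (p - 1) \<and> e * (\<Sum>i<Suc p. (exp (- \<beta> p * t) * r t i) * C i) > 0"
    by (rule eventually_conj)
  then obtain t where t: "t > y (p - 1)" "e * (\<Sum>i<Suc p. (exp (- \<beta> p * t) * r t i) * C i) > 0"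
    using eventually_happens by fastforce
  have "(\<Sum>i<Suc p. (exp (- \<beta> p * t) * r t i) * C i) = exp (- \<beta> p * t) * fdet (Suc p) (g(p := r t))"
    unfolding C sum_distrib_left by (simp only: mult.assoc)
  with t(2) have "0 < exp (- \<beta> p * t) * (e * fdet (Suc p) (g(p := r t)))"
    by (simp only: mult.left_commute)
  then have "e * fdet (Suc p) (g(p := r t)) > 0"
    by (simp only: zero_less_mult_iff exp_gt_zero) (auto simp: not_less)
  also have "fdet (Suc p) (g(p := r t)) = fdet (Suc p) (\<lambda>j i. exp (\<beta> (Suc p - 1 - i) * (y(p := t)) j))"
    by (intro fdet_cong) (auto simp: g_def r_def)
  also have "\<dots> = fdet (Suc p) (\<lambda>i j. exp (\<beta> (Suc p - 1 - i) * (y(p := t)) j))"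
    by (rule fdet_transpose)
  finally have "e * fdet (Suc p) (\<lambda>i j. exp (\<beta> (Suc p - 1 - i) * (y(p := t)) j)) > 0" .
  moreover have "strict_mono_on {..<Suc p} (y(p := t))"
  proof (rule strict_mono_onI)
    fix i j assume ij: "i \<in> {..<Suc p}" "j \<in> {..<Suc p}" "i < j"
    show "(y(p := t)) i < (y(p := t)) j"
    proof (cases "j = p")
      case True
      then have "y i \<le> y (p - 1)"
        using ij by (intro strict_mono_on_leD[OF y]) auto
      then show ?thesis using True ij t(1) by auto
    next
      case False
      then show ?thesis using ij strict_mono_onD[OF y, of i j] by auto
    qed
  qed
  ultimately show ?case unfolding e_def by blast
qed

text \<open>The points \<open>x\<^sub>p\<^sub>-\<^sub>1, x\<^sub>p\<^sub>-\<^sub>2, \<dots>\<close> are sent to infinity in this order.  After \<open>q\<close> steps the last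
  \<open>q\<close> rows span the \<open>q\<close> slowest exponentials, so the next limit sees only the exponent \<open>\<beta> q\<close>.\<close>

lemma exp_sum_minor_nonneg:
  fixes b \<beta> :: "nat \<Rightarrow> real"
  assumes tn: "totally_nonneg_kernel \<Lambda>"
    and \<beta>: "strict_mono_on {..<M} \<beta>"
    and \<Lambda>: "\<And>x. x \<ge> 0 \<Longrightarrow> \<Lambda> x = (\<Sum>k<M. b k * exp (- \<beta> k * x))"
    and "p \<le> M" and y: "strict_mono_on {..<p} y"
  shows "(\<Prod>k<p. b k) * fdet p (\<lambda>i j. exp (\<beta> (p - 1 - i) * y j)) \<ge> 0"
proof -
  \<comment> \<open>The exponential with exponent \<open>\<beta> k\<close> will replace row
    \<open>p - 1 - k\<close>, whence the reversed order of the exponents.\<close>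
  define row where "row = (\<lambda>k j. exp (\<beta> k * y j))"
  have "(\<Prod>k<q. b k) *
      fdet p (\<lambda>i. if i < p - q then (\<lambda>j. \<Lambda> (x i - y j)) else row (p - 1 - i)) \<ge> 0"
    if "q \<le> p" "strict_mono_on {..<p - q} x" for q x
    using that
  proof (induction q arbitrary: x)
    case 0
    have "fdet p (\<lambda>i. if i < p - 0 then (\<lambda>j. \<Lambda> (x i - y j)) else row (p - 1 - i)) =
          fdet p (\<lambda>i j. \<Lambda> (x i - y j))"
      by (rule fdet_cong) simp
    then show ?case
      using tn y 0 by (auto simp: totally_nonneg_kernel_fdet)
  next
    case (Suc q)
    \<comment> \<open>\<open>m\<close> is the last row that still contains \<open>\<Lambda>\<close>;
      its point is the next to go to infinity.\<close>
    define m where "m = p - Suc q"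
    have m: "m < p" "p - q = Suc m" "p - 1 - m = q" "q < M"
      using Suc.prems \<open>p \<le> M\<close> by (auto simp: m_def)
    define f where "f = (\<lambda>i. if i < m then (\<lambda>j. \<Lambda> (x i - y j)) else row (p - 1 - i))"
    obtain C where C: "\<And>r. fdet p (f(m := r)) = (\<Sum>j<p. r j * C j)"
      using fdet_row_expansion[OF m(1)] by metis
    \<comment> \<open>\<open>E k\<close> is the minor with row \<open>m\<close> replaced by
      \<open>row k\<close>. For \<open>k < q\<close> that row already occurs further down, so the
      minor vanishes.\<close>
    define E where "E = (\<lambda>k. \<Sum>j<p. row k j * C j)"
    have E0: "E k = 0" if "k < q" for k
    proof -
      have "E k = fdet p (f(m := row k))"
        by (simp add: E_def C)
      also have "\<dots> = 0"
        using that m by (intro fdet_identical_rows[of m p "p - 1 - k"]) (auto simp: f_def)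
      finally show ?thesis .
    qed
    have Eq: "E q = fdet p f"
    proof -
      have "f(m := row q) = f"
        using m by (auto simp: f_def fun_eq_iff)
      then show ?thesis unfolding E_def C[symmetric] by simp
    qed
    \<comment> \<open>After multiplication by \<open>exp (\<beta> q * t)\<close> the term
      \<open>k = q\<close> is constant; those with \<open>k < q\<close> vanish identically and those
      with \<open>k > q\<close> decay.\<close>
    have "((\<lambda>t. (\<Prod>k<q. b k) * (\<Sum>k<M. b k * exp ((\<beta> q - \<beta> k) * t) * E k))
           \<longlongrightarrow> (\<Prod>k<q. b k) * (\<Sum>k<M. if k = q then b q * E q else 0)) at_top"
    proof (intro tendsto_intros)
      fix k assume k: "k \<in> {..<M}"
      consider "k < q" | "k = q" | "q < k" by linarith
      then show "((\<lambda>t. b k * exp ((\<beta> q - \<beta> k) * t) * E k)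
          \<longlongrightarrow> (if k = q then b q * E q else 0)) at_top"
      proof cases
        case 3
        then have "\<beta> q - \<beta> k < 0" using strict_mono_onD[OF \<beta>, of q k] k m by simp
        from tendsto_mult[OF tendsto_mult[OF tendsto_const exp_mult_tendsto_0[OF this]] tendsto_const]
        show ?thesis using 3 by simp
      qed (simp_all add: E0)
    qed
    moreover have "\<forall>\<^sub>F t in at_top.
       0 \<le> (\<Prod>k<q. b k) * (\<Sum>k<M. b k * exp ((\<beta> q - \<beta> k) * t) * E k)"
      \<comment> \<open>Beyond \<open>x (m - 1)\<close> the points stay increasing; from
        \<open>y (p - 1)\<close> on every \<open>t - y j\<close> is nonnegative, where
        \<open>\<Lambda>\<close> is the exponential sum.\<close>
      using eventually_gt_at_top[of "x (m - 1)"] eventually_ge_at_top[of "y (p - 1)"]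
    proof eventually_elim
      case (elim t)
      have x: "strict_mono_on {..<p - q} (x(m := t))"
      proof (rule strict_mono_onI)
        fix i j assume ij: "i \<in> {..<p - q}" "j \<in> {..<p - q}" "i < j"
        show "(x(m := t)) i < (x(m := t)) j"
        proof (cases "j = m")
          case True
          then have "x i \<le> x (m - 1)"
            using ij by (intro strict_mono_on_leD[OF Suc.prems(2)]) (auto simp: m_def)
          then show ?thesis using True ij elim by auto
        next
          case False
          then have "j < p - Suc q" using ij m by (auto simp: m_def)
          then show ?thesis using False ij strict_mono_onD[OF Suc.prems(2), of i j] m_def by auto
        qed
      qed
      have "0 \<le> (\<Prod>k<q. b k) *
          fdet p (\<lambda>i. if i < p - q then (\<lambda>j. \<Lambda> ((x(m := t)) i - y j)) else row (p - 1 - i))"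
        using Suc.prems by (intro Suc.IH x) auto
      also have "fdet p (\<lambda>i. if i < p - q then (\<lambda>j. \<Lambda> ((x(m := t)) i - y j)) else row (p - 1 - i)) =
            fdet p (f(m := (\<lambda>j. \<Lambda> (t - y j))))"
        using m by (intro fdet_cong) (auto simp: f_def)
      also have "\<dots> = (\<Sum>j<p. \<Lambda> (t - y j) * C j)"
        by (rule C)
      also have "\<dots> = (\<Sum>j<p. \<Sum>k<M. b k * exp (- \<beta> k * t) * (row k j * C j))"
      proof (rule sum.cong)
        fix j assume "j \<in> {..<p}"
        then have "y j \<le> y (p - 1)" by (intro strict_mono_on_leD[OF y]) auto
        then have "t - y j \<ge> 0" using elim by simp
        then have "\<Lambda> (t - y j) = (\<Sum>k<M. b k * exp (- \<beta> k * t) * row k j)"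
          by (simp add: \<Lambda> row_def mult.assoc right_diff_distrib flip: exp_add)
        then show "\<Lambda> (t - y j) * C j = (\<Sum>k<M. b k * exp (- \<beta> k * t) * (row k j * C j))"
          by (simp only: sum_distrib_right mult.assoc)
      qed simp
      also have "\<dots> = (\<Sum>k<M. b k * exp (- \<beta> k * t) * E k)"
        unfolding E_def sum_distrib_left by (rule sum.swap)
      finally have "0 \<le> exp (\<beta> q * t) * ((\<Prod>k<q. b k) * (\<Sum>k<M. b k * exp (- \<beta> k * t) * E k))"
        by simp
      also have "\<dots> = (\<Prod>k<q. b k) * (\<Sum>k<M. b k * exp ((\<beta> q - \<beta> k) * t) * E k)"
        by (simp add: sum_distrib_left left_diff_distrib exp_diff exp_minus field_simps)
      finally show ?case .
    qed
    ultimately have "0 \<le> (\<Prod>k<q. b k) * (\<Sum>k<M. if k = q then b q * E q else 0)"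
      by (rule tendsto_lowerbound) simp
    also have "\<dots> = (\<Prod>k<Suc q. b k) * fdet p f"
      using m by (simp add: Eq)
    finally show ?case by (simp add: f_def m_def)
  qed
  from this[of p "\<lambda>_. 0"] show ?thesis
    by (simp add: row_def strict_mono_on_def)
qed

text \<open>With \<open>y\<close> from \<open>exp_minor_sign\<close>, the minor of exponentials is
  non-zero of known sign. Comparison with \<open>exp_sum_minor_nonneg\<close> gives the sign of the
  product of the first \<open>p\<close> coefficients for each \<open>p \<le> M\<close>; two
  consecutive products isolate one coefficient.\<close>

lemma exp_sum_coeff_alternate:
  fixes b \<beta> :: "nat \<Rightarrow> real"
  assumes tn: "totally_nonneg_kernel \<Lambda>"
    and \<beta>: "strict_mono_on {..<M} \<beta>"
    and \<Lambda>: "\<And>x. x \<ge> 0 \<Longrightarrow> \<Lambda> x = (\<Sum>k<M. b k * exp (- \<beta> k * x))"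
    and b: "\<And>k. k < M \<Longrightarrow> b k \<noteq> 0" and "k < M"
  shows "(-1) ^ k * b k > 0"
proof -
  have pos: "(\<Prod>k<p. (-1) ^ k * b k) > 0" if p: "p \<le> M" for p
  proof -
    have "strict_mono_on {..<p} \<beta>"
      using \<beta> p by (auto simp: strict_mono_on_def)
    from exp_minor_sign[OF this] obtain y where y: "strict_mono_on {..<p} y"
      and s: "(\<Prod>k<p. (-1) ^ k) * fdet p (\<lambda>i j. exp (\<beta> (p - 1 - i) * y j)) > 0"
      by blast
    define D where "D = fdet p (\<lambda>i j. exp (\<beta> (p - 1 - i) * y j))"
    define P where "P = (\<Prod>k<p. b k)"
    have "P * D \<ge> 0"
      unfolding D_def P_def by (rule exp_sum_minor_nonneg[OF tn \<beta> \<Lambda> p y])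
    moreover have "P \<noteq> 0"
      using b p by (auto simp: P_def)
    ultimately show ?thesis
      using s unfolding D_def[symmetric] P_def[symmetric] prod.distrib
      by (auto simp: zero_less_mult_iff zero_le_mult_iff)
  qed
  have "(\<Prod>k<k. (-1) ^ k * b k) * ((-1) ^ k * b k) > 0"
    using pos[of "Suc k"] \<open>k < M\<close> by simp
  then show ?thesis
    using pos[of k] \<open>k < M\<close> by (simp only: zero_less_mult_iff) auto
qed

text \<open>Listed by increasing exponent, the coefficients have signs 1, -1, 1, ..., which add up
  to 0 or 1. The bound mentions no ordering of the exponents, so it applies when that ordering is
  unknown.\<close>

lemma exp_sum_sgn_sum_le_1:
  fixes B E :: "'a \<Rightarrow> real"
  assumes tn: "totally_nonneg_kernel \<Lambda>"
    and S: "finite S" "inj_on E S"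
    and \<Lambda>: "\<And>x. x \<ge> 0 \<Longrightarrow> \<Lambda> x = (\<Sum>s\<in>S. B s * exp (- E s * x))"
    and B: "\<And>s. s \<in> S \<Longrightarrow> B s \<noteq> 0"
  shows "(\<Sum>s\<in>S. sgn (B s)) \<le> 1"
proof -
  define xs where "xs = sorted_list_of_set (E ` S)"
  define M where "M = length xs"
  define h where "h = (\<lambda>k. inv_into S E (xs ! k))"
  have xs: "set xs = E ` S" "distinct xs" "sorted_wrt (<) xs"
    using S by (auto simp: xs_def)
  have "bij_betw ((!) xs) {..<M} (E ` S)"
    by (rule bij_betw_nth) (use xs in \<open>auto simp: M_def\<close>)
  moreover have "bij_betw (inv_into S E) (E ` S) S"
    using S by (simp add: bij_betw_imageI inj_on_inv_into)
  ultimately have h: "bij_betw h {..<M} S"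
    unfolding h_def using bij_betw_trans[of "(!) xs"] by (auto simp: comp_def)
  have Eh: "E (h k) = xs ! k" if "k < M" for k
    unfolding h_def using xs(1) that by (intro f_inv_into_f) (auto simp: M_def)
  have mono: "strict_mono_on {..<M} (\<lambda>k. E (h k))"
    using sorted_wrt_nth_less[OF xs(3)] by (intro strict_mono_onI) (auto simp: Eh M_def)
  have alt: "(-1) ^ k * B (h k) > 0" if "k < M" for k
  proof (rule exp_sum_coeff_alternate[OF tn mono _ _ that])
    show "\<Lambda> x = (\<Sum>k<M. B (h k) * exp (- E (h k) * x))" if "x \<ge> 0" for x
      using \<Lambda>[OF that] sum.reindex_bij_betw[OF h, of "\<lambda>s. B s * exp (- E s * x)"] by simp
    show "B (h k) \<noteq> 0" if "k < M" for k
      using B h that by (auto simp: bij_betw_def)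
  qed
  have "(\<Sum>s\<in>S. sgn (B s)) = (\<Sum>k<M. sgn (B (h k)))"
    by (rule sum.reindex_bij_betw[OF h, symmetric])
  also have "\<dots> = (\<Sum>k<M. (-1) ^ k)"
  proof (rule sum.cong)
    fix k assume "k \<in> {..<M}"
    then show "sgn (B (h k)) = (-1) ^ k"
      using alt[of k] by (cases "even k") auto
  qed simp
  also have "\<dots> = (if even M then 0 else 1)"
    by (induction M) auto
  finally show ?thesis by (simp split: if_splits)
qed

section \<open>The kernel and its powers\<close>

text \<open>As \<open>\<phi>\<close> vanishes at 0, its truncation equals
  \<open>\<phi> (max x 0)\<close> and is continuous; it is differentiable off 0, and the fundamental
  theorem tolerates that exceptional point.\<close>

lemma has_integral_truncate:
  fixes \<phi> \<phi>' :: "real \<Rightarrow> real"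
  assumes deriv: "\<And>x. (\<phi> has_real_derivative \<phi>' x) (at x)" and "\<phi> 0 = 0" and "u \<le> v"
  shows "((\<lambda>x. if x \<ge> 0 then \<phi>' x else 0) has_integral
           (if v \<ge> 0 then \<phi> v else 0) - (if u \<ge> 0 then \<phi> u else 0)) {u..v}"
proof (rule fundamental_theorem_of_calculus_strong[of "{0}"])
  let ?g = "\<lambda>x. if x \<ge> 0 then \<phi> x else 0"
  have "continuous_on UNIV \<phi>"
    by (rule DERIV_continuous_on[OF deriv])
  then have "continuous_on {u..v} (\<lambda>x. \<phi> (max x 0))"
    by (rule continuous_on_compose2) (auto intro!: continuous_intros)
  moreover have "(\<lambda>x. \<phi> (max x 0)) = ?g"
    using \<open>\<phi> 0 = 0\<close> by (auto simp: fun_eq_iff max_def)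
  ultimately show "continuous_on {u..v} ?g" by (simp only:)
  fix x assume "x \<in> {u..v} - {0}"
  then consider "x > 0" | "x < 0" by fastforce
  then have "(?g has_real_derivative (if x \<ge> 0 then \<phi>' x else 0)) (at x)"
  proof cases
    case 1
    have "(?g has_real_derivative \<phi>' x) (at x)"
      by (rule has_field_derivative_transform_within_open[OF deriv, where S = "{0<..}"]) (use 1 in auto)
    then show ?thesis using 1 by simp
  next
    case 2
    have "(?g has_real_derivative 0) (at x)"
      by (rule has_field_derivative_transform_within_open[OF DERIV_const[of 0], where S = "{..<0}"])
         (use 2 in auto)
    then show ?thesis using 2 by simp
  qed
  then show "(?g has_vector_derivative (if x \<ge> 0 then \<phi>' x else 0)) (at x)"
    by (simp only: has_real_derivative_iff_has_vector_derivative)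
qed (use \<open>u \<le> v\<close> in auto)

text \<open>The binomial theorem is applied twice, splitting off \<open>v\<close> first, so that the
  outer index \<open>k\<close> is the exponent of the middle term, the one that will carry the
  sign.\<close>

lemma trinomial:
  fixes u v w :: "'a :: comm_semiring_1"
  shows "(u + v + w) ^ n = (\<Sum>(k, l)\<in>(SIGMA k:{..n}. {..n - k}).
           of_nat (n choose k) * of_nat (n - k choose l) * (u ^ (n - k - l) * v ^ k * w ^ l))"
proof -
  have "(u + v + w) ^ n = (v + (w + u)) ^ n"
    by (simp add: ac_simps)
  also have "\<dots> = (\<Sum>k\<le>n. \<Sum>l\<le>n - k.
      of_nat (n choose k) * of_nat (n - k choose l) * (u ^ (n - k - l) * v ^ k * w ^ l))"
    unfolding binomial_ring sum_distrib_left by (simp add: ac_simps)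
  finally show ?thesis by (simp add: sum.Sigma)
qed

text \<open>A fixed \<open>k\<close> occurs for n - k + 1 values of \<open>l\<close>. Splitting off
  \<open>k = 0\<close> shows that the sums satisfy s(n + 1) = n + 2 - s(n), as does the right-hand
  side.\<close>

lemma alternating_simplex_sum:
  "(\<Sum>(k, l)\<in>(SIGMA k:{..n}. {..n - k}). (-1) ^ k) = real (n div 2) + 1"
proof -
  have "(\<Sum>k\<le>n. (-1) ^ k * real (Suc (n - k))) = real (n div 2) + 1"
  proof (induction n)
    case 0
    show ?case by simp
  next
    case (Suc n)
    have "(\<Sum>k\<le>Suc n. (-1) ^ k * real (Suc (Suc n - k))) =
          real n + 2 - (\<Sum>k\<le>n. (-1) ^ k * real (Suc (n - k)))"
      by (subst sum.atMost_Suc_shift) (simp add: sum_negf)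
    also have "\<dots> = real n + 1 - real (n div 2)"
      unfolding Suc.IH by simp
    also have "real n = real (Suc n div 2) + real (n div 2)"
      unfolding of_nat_add[symmetric] of_nat_eq_iff by linarith
    finally show ?case by simp
  qed
  then show ?thesis
    by (simp add: mult.commute flip: sum.Sigma)
qed

text \<open>Independence concerns the set, so a relation is a coefficient function \<open>u\<close>
  on it; as the three numbers are distinct, \<open>u\<close> can take the three prescribed
  values.\<close>

lemma rat_independent_int_relation:
  fixes p q r :: int
  assumes "rat_independent {a1, a2, a3}" "a1 \<noteq> a2" "a1 \<noteq> a3" "a2 \<noteq> a3"
    and "of_int p * a1 + of_int q * a2 + of_int r * a3 = 0"
  shows "p = 0" "q = 0" "r = 0"
proof -
  interpret Modules.module "\<lambda>(q::rat) (x::real). of_rat q * x"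
    by unfold_locales (auto simp: algebra_simps of_rat_add of_rat_mult)
  define u :: "real \<Rightarrow> rat" where
    "u = (\<lambda>v. if v = a1 then of_int p else if v = a2 then of_int q else of_int r)"
  have "(\<Sum>v\<in>{a1, a2, a3}. of_rat (u v) * v) = 0"
    using assms(2-5) by (simp add: u_def add.assoc)
  then have "u v = 0" if "v \<in> {a1, a2, a3}" for v
    using independentD[OF assms(1) _ subset_refl] that by auto
  from this[of a1] this[of a2] this[of a3] show "p = 0" "q = 0" "r = 0"
    using assms(2-4) by (auto simp: u_def)
qed

lemma set_integrable_exp_neg:
  fixes a :: real
  assumes "a > 0"
  shows "set_integrable lebesgue {0..} (\<lambda>x. exp (- a * x))"
  by (rule nonnegative_absolutely_integrable_1)
     (use integrable_on_exp_minus_to_infinity[OF assms, of 0] in auto)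

lemma power_not_totally_nonneg_kernel:
  fixes a1 a2 a3 c1 c2 c3 :: real
  assumes ind: "rat_independent {a1, a2, a3}" "a1 \<noteq> a2" "a1 \<noteq> a3" "a2 \<noteq> a3"
    and c: "c1 > 0" "c2 < 0" "c3 > 0"
    and \<Lambda>: "\<And>x. x \<ge> 0 \<Longrightarrow>
           \<Lambda> x = (c1 * exp (- a1 * x) + c2 * exp (- a2 * x) + c3 * exp (- a3 * x)) ^ n"
    and n: "n \<ge> 2"
  shows "\<not> totally_nonneg_kernel \<Lambda>"
proof
  assume tn: "totally_nonneg_kernel \<Lambda>"
  define S where "S = (SIGMA k:{..n}. {..n - k})"
  \<comment> \<open>Exponent and coefficient of the terms in which the exponentials with
    \<open>a2\<close> and \<open>a3\<close> occur \<open>k\<close> and \<open>l\<close>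
    times.\<close>
  define E where "E = (\<lambda>(k, l). real (n - k - l) * a1 + real k * a2 + real l * a3)"
  define B where "B = (\<lambda>(k, l). real (n choose k) * real (n - k choose l) *
                          (c1 ^ (n - k - l) * c2 ^ k * c3 ^ l))"
  have sgnB: "sgn (B s) = (case s of (k, l) \<Rightarrow> (-1) ^ k)" if sS: "s \<in> S" for s
  proof -
    obtain k l where s: "s = (k, l)" "k \<le> n" "l \<le> n - k"
      using sS by (auto simp: S_def)
    have "sgn (B s) = sgn (c2 ^ k)"
      using s c by (simp add: B_def sgn_mult)
    also have "\<dots> = (-1) ^ k"
      using c by (cases "even k") (auto simp: zero_less_power_eq power_less_zero_eq)
    finally show ?thesis using s by simp
  qed
  have "(\<Sum>s\<in>S. sgn (B s)) \<le> 1"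
  proof (rule exp_sum_sgn_sum_le_1[OF tn])
    show "finite S" by (simp add: S_def)
    show "inj_on E S"
    proof (rule inj_onI)
      fix s s' assume "s \<in> S" "s' \<in> S" and E: "E s = E s'"
      then obtain k l k' l' where s: "s = (k, l)" "k \<le> n" "l \<le> n - k"
        "s' = (k', l')" "k' \<le> n" "l' \<le> n - k'"
        by (auto simp: S_def)
      \<comment> \<open>Equal exponents give an integer relation; its coefficients of
        \<open>a2\<close> and \<open>a3\<close> are the differences of the indices.\<close>
      have "of_int (int k' + int l' - int k - int l) * a1 + of_int (int k - int k') * a2
             + of_int (int l - int l') * a3 = 0"
        using E s by (simp add: E_def of_nat_diff algebra_simps)
      from rat_independent_int_relation[OF ind this] show "s = s'"
        using s by simp
    qed
    show "\<Lambda> x = (\<Sum>s\<in>S. B s * exp (- E s * x))" if "x \<ge> 0" for x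
    proof -
      have "exp (- a1 * x) ^ (n - k - l) * exp (- a2 * x) ^ k * exp (- a3 * x) ^ l =
            exp (- E (k, l) * x)" for k l
        by (simp add: E_def algebra_simps flip: exp_of_nat_mult exp_add)
      then show ?thesis
        unfolding \<Lambda>[OF that] trinomial S_def B_def
        by (intro sum.cong refl) (auto simp: power_mult_distrib mult_ac)
    qed
    show "B s \<noteq> 0" if "s \<in> S" for s
      using sgnB[OF that] by (auto split: prod.splits)
  qed
  moreover have "(\<Sum>s\<in>S. sgn (B s)) = real (n div 2) + 1"
    using alternating_simplex_sum[of n] by (simp add: sgnB flip: S_def)
  ultimately show False using n by simp
qed

theorem lemma10p2:
  fixes a1 a2 a3 c1 c2 c3 :: real and N :: "real \<Rightarrow> real"
  assumes "0 < a1" and "a1 < a2" and "a2 < a3"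
    and "rat_independent {a1, a2, a3}"
    and "c1 \<noteq> 0" and "c2 \<noteq> 0" and "c3 \<noteq> 0"
    and "c1 > 0"
    and "c1 + c2 + c3 = 0"
    and "a1 * c1 + a2 * c2 + a3 * c3 = 0"
    and "\<And>x. N x = (if x \<ge> 0
               then c1 * exp (- a1 * x) + c2 * exp (- a2 * x) + c3 * exp (- a3 * x)
               else 0)"
  shows "continuous_on UNIV N \<and> polya_frequency_function N \<and>
         (\<forall>n::nat. n \<ge> 2 \<longrightarrow> \<not> polya_frequency_function (\<lambda>x. N x ^ n))"
proof -
  note N = assms(11)
  \<comment> \<open>Eliminating \<open>c3\<close> from the two linear relations gives c1 (a3 - a1) +
    c2 (a3 - a2) = 0; \<open>\<kappa>\<close> is the common size of these products and becomes the
    factor in the derivative of \<open>P\<close>.\<close>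
  define \<kappa> where "\<kappa> = c1 * (a3 - a1)"
  have \<kappa>: "\<kappa> > 0"
    using assms(2,3,8) by (simp add: \<kappa>_def)
  have c3_eq: "c3 = - c1 - c2" using assms(9) by simp
  have \<kappa>': "c2 * (a3 - a2) = - \<kappa>"
    using assms(10) unfolding c3_eq \<kappa>_def by (simp add: algebra_simps)
  have c2: "c2 < 0"
    using \<kappa> \<kappa>' assms(3) by (smt (verit) mult_nonneg_nonneg)
  have "c3 * (a3 - a2) = c1 * (a2 - a1)"
    using assms(10) unfolding c3_eq by (simp add: algebra_simps)
  then have c3: "c3 > 0"
    using assms(1-3,8) by (smt (verit) mult_pos_pos mult_nonpos_nonneg)
  \<comment> \<open>On x >= 0, \<open>P\<close> is \<open>N\<close> times exp(a3 x). Its derivative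
    is an exponential multiple of \<open>K\<close>, and that of \<open>K\<close> is a multiple of an
    exponential. As both vanish at 0, \<open>N\<close> arises from the step function by scaling and
    taking primitives in turn.\<close>
  define K where "K = (\<lambda>x. exp ((a2 - a1) * x) - 1)"
  define P where "P = (\<lambda>x. c1 * exp ((a3 - a1) * x) + c2 * exp ((a3 - a2) * x) + c3)"
  have P0: "P 0 = 0" using assms(9) by (simp add: P_def)
  have K': "(K has_real_derivative (a2 - a1) * exp ((a2 - a1) * x)) (at x)" for x
    unfolding K_def by (auto intro!: derivative_eq_intros)
  have P': "(P has_real_derivative \<kappa> * exp ((a3 - a2) * x) * K x) (at x)" for x
  proof -
    have "(P has_real_derivative \<kappa> * exp ((a3 - a1) * x) + c2 * (a3 - a2) * exp ((a3 - a2) * x)) (at x)"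
      unfolding P_def \<kappa>_def by (auto intro!: derivative_eq_intros)
    also have "\<kappa> * exp ((a3 - a1) * x) + c2 * (a3 - a2) * exp ((a3 - a2) * x) =
          \<kappa> * exp ((a3 - a2) * x) * K x"
      unfolding \<kappa>' K_def by (simp add: algebra_simps flip: exp_add)
    finally show ?thesis .
  qed
  have NP: "N x = 1 * exp (- a3 * x) * (if x \<ge> 0 then P x else 0)" for x
    by (simp add: N P_def algebra_simps flip: exp_add)

  \<comment> \<open>Total nonnegativity of \<open>N\<close>\<close>
  have "totally_nonneg_kernel (\<lambda>x. if x \<ge> 0 then K x else 0)"
  proof (rule totally_nonneg_kernel_primitive)
    show "totally_nonneg_kernel
        (\<lambda>x. (a2 - a1) * exp ((a2 - a1) * x) * (if x \<ge> 0 then 1 else 0))"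
      by (rule totally_nonneg_kernel_exp_scale[OF totally_nonneg_kernel_heaviside])
         (use assms(2) in simp)
    show "((\<lambda>x. (a2 - a1) * exp ((a2 - a1) * x) * (if x \<ge> 0 then 1 else 0)) has_integral
        (if v \<ge> 0 then K v else 0) - (if u \<ge> 0 then K u else 0)) {u..v}" if "u \<le> v" for u v
      using has_integral_truncate[OF K' _ that] by (simp add: K_def if_distrib cong: if_cong)
  qed simp
  from totally_nonneg_kernel_exp_scale[OF this, of \<kappa> "a3 - a2"]
  have "totally_nonneg_kernel (\<lambda>x. \<kappa> * exp ((a3 - a2) * x) * (if x \<ge> 0 then K x else 0))"
    using \<kappa> by simp
  then have "totally_nonneg_kernel (\<lambda>x. if x \<ge> 0 then P x else 0)"
  proof (rule totally_nonneg_kernel_primitive)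
    show "((\<lambda>x. \<kappa> * exp ((a3 - a2) * x) * (if x \<ge> 0 then K x else 0)) has_integral
        (if v \<ge> 0 then P v else 0) - (if u \<ge> 0 then P u else 0)) {u..v}" if "u \<le> v" for u v
      using has_integral_truncate[OF P' P0 that] by (simp add: if_distrib cong: if_cong)
  qed simp
  from totally_nonneg_kernel_exp_scale[OF this, of 1 "- a3"]
  have tn: "totally_nonneg_kernel N"
    unfolding NP[abs_def] by simp

  \<comment> \<open>Positivity of \<open>N\<close> on the positive axis\<close>
  have "P x > 0" if "x > 0" for x
  proof -
    have "P 0 < P x"
    proof (rule DERIV_pos_imp_increasing_open[OF that])
      fix t :: real assume "0 < t"
      then have "\<kappa> * exp ((a3 - a2) * t) * K t > 0"
        using \<kappa> assms(2) by (simp add: K_def)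
      then show "\<exists>y. (P has_real_derivative y) (at t) \<and> y > 0"
        using P' by blast
    qed (rule DERIV_continuous_on[OF has_field_derivative_at_within[OF P']])
    then show ?thesis by (simp add: P0)
  qed
  then have pos: "N x > 0" if "x > 0" for x
    using that by (simp add: NP)
  have nonneg: "N x \<ge> 0" for x
    using pos[of x] by (cases "x = 0") (auto simp: NP P0 not_less)

  \<comment> \<open>Continuity, integrability and the powers of \<open>N\<close>\<close>
  have "continuous_on UNIV (\<lambda>x. exp (- a3 * x) * P (max x 0))"
    unfolding P_def by (intro continuous_intros)
  also have "(\<lambda>x. exp (- a3 * x) * P (max x 0)) = N"
    by (auto simp: fun_eq_iff NP P0 max_def)
  finally have cont: "continuous_on UNIV N" .

  have "set_integrable lebesgue {0..}
          (\<lambda>x. c1 * exp (- a1 * x) + c2 * exp (- a2 * x) + c3 * exp (- a3 * x))"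
    using assms(1-3) by (intro set_integral_add set_integrable_mult_right set_integrable_exp_neg) auto
  also have "?this \<longleftrightarrow> integrable lebesgue N"
    unfolding set_integrable_def
    by (intro Bochner_Integration.integrable_cong) (auto simp: N indicator_def)
  finally have "integrable lebesgue N" .
  moreover have "\<exists>x y. x \<noteq> y \<and> N x \<noteq> 0 \<and> N y \<noteq> 0"
    using pos[of 1] pos[of 2] by (intro exI[of _ 1] exI[of _ 2]) auto
  ultimately have "polya_frequency_function N"
    using nonneg tn by (simp add: polya_frequency_function_def)
  moreover have "\<not> polya_frequency_function (\<lambda>x. N x ^ n)" if "n \<ge> 2" for n
  proof -
    have "\<not> totally_nonneg_kernel (\<lambda>x. N x ^ n)"
      by (rule power_not_totally_nonneg_kernel[OF assms(4) _ _ _ assms(8) c2 c3 _ that])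
         (use assms(1-3) N in auto)
    then show ?thesis by (simp add: polya_frequency_function_def)
  qed
  ultimately show ?thesis using cont by blast
qed

end
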